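(* On the set of the $512$ mesh patterns $(12,R)$, $R\subseteq\{0,1,2\}\times\{0,1,2\}$, the equivalence relation of coincidence under $231$ (that is, $p_1\sim p_2$ if and only if $\mathrm{Av}(\{231,p_1\})=\mathrm{Av}(\{231,p_2\})$) has exactly $56$ equivalence classes.
   Context: Write $[n]=\{1,\dots,n\}$. A permutation of length $n$ is a bijection of $[n]$, written in one-line notation; $G(\pi)=\{(i,\pi(i)) : i\in[n]\}$ is its plot. A mesh pattern of length $k$ is a pair $p=(\tau,R)$ with $\tau$ a permutation of length $k$ and $R\subseteq\{0,\dots,k\}^2$. An occurrence of $p$ in a permutation $\pi$ of length $n$ is a subset $\omega\subseteq G(\pi)$ for which there are order-preserving injections $\alpha,\beta:[k]\to[n]$ such that (i) $\omega=\{(\alpha(i),\beta(j)):(i,j)\in G(\tau)\}$, and (ii) with $\alpha(0)=\beta(0)=0$, $\alpha(k+1)=\beta(k+1)=n+1$ and $R_{ij}=[\alpha(i)+1,\alpha(i+1)-1]\times[\beta(j)+1,\beta(j+1)-1]$, one has $R_{ij}\cap G(\pi)=\emptyset$ for every $(i,j)\in R$. A permutation avoids $p$ if it has no occurrence of $p$. A classical pattern $\pi$ is identified with the mesh pattern $(\pi,\emptyset)$. $\mathrm{Av}(S)$ is the set of all permutations (of all lengths, including the empty one) avoiding every pattern in $S$. *)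

theory Defs
  imports "HOL-Combinatorics.Multiset_Permutations"
begin

text \<open>
  A permutation is represented by its one-line notation, a word over \<open>{1..n}\<close>
  (indexed from 1 as in the plot below, although list access starts at 0).
  Its length is the length of the word; the word \<open>[]\<close> is the empty permutation.
\<close>

definition is_perm :: "nat list \<Rightarrow> bool" where
  "is_perm \<pi> \<longleftrightarrow> \<pi> \<in> permutations_of_set {1..length \<pi>}"

definition plot :: "nat list \<Rightarrow> (nat \<times> nat) set" where
  "plot \<pi> = {(i, \<pi> ! (i - 1)) | i. i \<in> {1..length \<pi>}}"

type_synonym mesh_pattern = "nat list \<times> (nat \<times> nat) set"

definition is_mesh_pattern :: "mesh_pattern \<Rightarrow> bool" where
  "is_mesh_pattern p \<longleftrightarrow>
     is_perm (fst p) \<and> snd p \<subseteq> {0..length (fst p)} \<times> {0..length (fst p)}"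

definition classical :: "nat list \<Rightarrow> mesh_pattern" where
  "classical \<tau> = (\<tau>, {})"

text \<open>
  An order-preserving injection of \<open>{1..k}\<close> into \<open>{1..n}\<close>, extended by
  \<open>0 \<mapsto> 0\<close> and \<open>k + 1 \<mapsto> n + 1\<close>; values at arguments beyond \<open>k + 1\<close> play no role.
\<close>

definition bordered_embedding :: "nat \<Rightarrow> nat \<Rightarrow> (nat \<Rightarrow> nat) \<Rightarrow> bool" where
  "bordered_embedding k n \<alpha> \<longleftrightarrow>
     strict_mono_on {1..k} \<alpha> \<and> \<alpha> ` {1..k} \<subseteq> {1..n} \<and> \<alpha> 0 = 0 \<and> \<alpha> (k + 1) = n + 1"

text \<open>The truncated subtraction is harmless: \<open>\<alpha> (i + 1)\<close> and \<open>\<beta> (j + 1)\<close> are positive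
  for \<open>i, j \<le> k\<close>.\<close>

definition cell :: "(nat \<Rightarrow> nat) \<Rightarrow> (nat \<Rightarrow> nat) \<Rightarrow> nat \<Rightarrow> nat \<Rightarrow> (nat \<times> nat) set" where
  "cell \<alpha> \<beta> i j = {\<alpha> i + 1..\<alpha> (i + 1) - 1} \<times> {\<beta> j + 1..\<beta> (j + 1) - 1}"

definition occurrence :: "mesh_pattern \<Rightarrow> nat list \<Rightarrow> (nat \<times> nat) set \<Rightarrow> bool" where
  "occurrence p \<pi> \<omega> \<longleftrightarrow>
     \<omega> \<subseteq> plot \<pi> \<and>
     (\<exists>\<alpha> \<beta>. bordered_embedding (length (fst p)) (length \<pi>) \<alpha> \<and>
            bordered_embedding (length (fst p)) (length \<pi>) \<beta> \<and>
            \<omega> = {(\<alpha> i, \<beta> j) | i j. (i, j) \<in> plot (fst p)} \<and>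
            (\<forall>(i, j) \<in> snd p. cell \<alpha> \<beta> i j \<inter> plot \<pi> = {}))"

definition avoids :: "nat list \<Rightarrow> mesh_pattern \<Rightarrow> bool" where
  "avoids \<pi> p \<longleftrightarrow> \<not> (\<exists>\<omega>. occurrence p \<pi> \<omega>)"

definition Av :: "mesh_pattern set \<Rightarrow> nat list set" where
  "Av S = {\<pi>. is_perm \<pi> \<and> (\<forall>p \<in> S. avoids \<pi> p)}"

definition mesh_patterns_of :: "nat list \<Rightarrow> mesh_pattern set" where
  "mesh_patterns_of \<tau> = {p. is_mesh_pattern p \<and> fst p = \<tau>}"

definition coincidence_under :: "nat list \<Rightarrow> mesh_pattern set \<Rightarrow> (mesh_pattern \<times> mesh_pattern) set" where
  "coincidence_under \<sigma> M =
     {(p1, p2) \<in> M \<times> M. Av {classical \<sigma>, p1} = Av {classical \<sigma>, p2}}"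

end

theory Submission
  imports Defs
begin

text \<open>
  Fix an occurrence \<open>(a, b)\<close> of \<open>12\<close> in a permutation avoiding \<open>231\<close> and suppose that some point
  lies in cell \<open>(i, j)\<close> with \<open>i, j \<le> 1\<close>. Replacing \<open>a\<close> by an extremal point of that cell gives an
  occurrence for which the cell is empty; avoidance of \<open>231\<close> forces most of the other
  cells not to become occupied. So under suitable conditions on \<open>R\<close> a cell can be shaded without
  changing the avoidance class. Five such rules and their mirror images under the symmetry
  \<open>(i, j) \<mapsto> (2 - j, 2 - i)\<close>, together with the fact that cell \<open>(2, 0)\<close> is always empty, connect the
  512 patterns into 56 groups, and twelve permutations of length at most five separate these groups.
\<close>

section \<open>Shading rules\<close>

text \<open>The junk case \<open>x \<in> {a, b}\<close> never matters: only points other than \<open>a\<close> and \<open>b\<close> are classified.\<close>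

definition third :: "'a::linorder \<Rightarrow> 'a \<Rightarrow> 'a \<Rightarrow> nat" where
  "third a b x = (if x < a then 0 else if x < b then 1 else 2)"

text \<open>Points carry two integer coordinates instead of being positions of a word, so that the
  mirror symmetry is the substitution of \<open>- g\<close> and \<open>- f\<close> for
  \<open>f\<close> and \<open>g\<close>.\<close>

locale avoids_231 =
  fixes P :: "'a set" and f g :: "'a \<Rightarrow> int"
  assumes finite: "finite P"
    and inj_f: "inj_on f P" and inj_g: "inj_on g P"
    and no_231: "\<lbrakk>x \<in> P; y \<in> P; z \<in> P; f x < f y; f y < f z; g z < g x; g x < g y\<rbrakk> \<Longrightarrow> False"
begin

definition box :: "'a \<Rightarrow> 'a \<Rightarrow> 'a \<Rightarrow> nat \<times> nat" where
  "box a b p = (third (f a) (f b) (f p), third (g a) (g b) (g p))"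

definition occ :: "(nat \<times> nat) set \<Rightarrow> 'a \<Rightarrow> 'a \<Rightarrow> bool" where
  "occ R a b \<longleftrightarrow> a \<in> P \<and> b \<in> P \<and> f a < f b \<and> g a < g b \<and> (\<forall>p \<in> P - {a, b}. box a b p \<notin> R)"

definition contains :: "(nat \<times> nat) set \<Rightarrow> bool" where
  "contains R \<longleftrightarrow> (\<exists>a b. occ R a b)"

lemma contains_subset: "contains R \<Longrightarrow> S \<subseteq> R \<Longrightarrow> contains S"
  by (fastforce simp: contains_def occ_def)

text \<open>Common frame of the shading rules. If the cell is occupied, its point \<open>z\<close>
  minimising \<open>h\<close> replaces \<open>a\<close>. The old \<open>a\<close> then lies in cell
  \<open>(1 - i, 1 - j)\<close>, hence \<open>opp\<close>. Premise \<open>new\<close> says that no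
  other point ends up in a shaded cell.\<close>

lemma contains_insertI:
  fixes h :: "'a \<Rightarrow> int"
  assumes "contains R" and ij: "i < 2" "j < 2" and opp: "(1 - i, 1 - j) \<notin> R"
    and new: "\<And>a b z p. \<lbrakk>a \<in> P; b \<in> P; z \<in> P; p \<in> P;
      f a < f b; g a < g b; f z < f b; g z < g b; i = 0 \<longleftrightarrow> f z < f a; j = 0 \<longleftrightarrow> g z < g a;
      f z \<noteq> f a; f p \<noteq> f a; f p \<noteq> f b; f p \<noteq> f z; g z \<noteq> g a; g p \<noteq> g a; g p \<noteq> g b; g p \<noteq> g z;
      box a b p \<notin> R; box a b p = (i, j) \<Longrightarrow> h z \<le> h p; box z b p \<in> insert (i, j) R\<rbrakk> \<Longrightarrow> False"
  shows "contains (insert (i, j) R)"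
proof -
  obtain a b where o: "occ R a b" using assms(1) by (auto simp: contains_def)
  then have ab: "a \<in> P" "b \<in> P" "f a < f b" "g a < g b" by (auto simp: occ_def)
  let ?Z = "{p \<in> P - {a, b}. box a b p = (i, j)}"
  show ?thesis
  proof (cases "?Z = {}")
    case True
    then have "occ (insert (i, j) R) a b" using o by (auto simp: occ_def)
    then show ?thesis by (auto simp: contains_def)
  next
    case False
    define z where "z = arg_min_on h ?Z"
    have "finite ?Z" using finite by auto
    from arg_min_if_finite[OF this False, of h]
    have "z \<in> ?Z" and min: "\<And>p. p \<in> ?Z \<Longrightarrow> h z \<le> h p"
      unfolding z_def by (auto simp: not_less[symmetric])
    then have z: "z \<in> P" "z \<noteq> a" "z \<noteq> b" "box a b z = (i, j)" by auto
    then have za: "f z \<noteq> f a" "g z \<noteq> g a"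
      using ab inj_f inj_g by (auto dest: inj_onD)
    have zb: "f z < f b" "g z < g b" "i = 0 \<longleftrightarrow> f z < f a" "j = 0 \<longleftrightarrow> g z < g a"
      using z(4) ij ab by (auto simp: box_def third_def split: if_splits)
    have box_a: "box z b a = (1 - i, 1 - j)"
      using zb za ab ij by (auto simp: box_def third_def)
    have "occ (insert (i, j) R) z b"
      unfolding occ_def
    proof (intro conjI ballI)
      fix p assume p: "p \<in> P - {z, b}"
      show "box z b p \<notin> insert (i, j) R"
      proof (cases "p = a")
        case True
        \<comment> \<open>Hence the cell of \<open>a\<close> also differs from the newly shaded
          \<open>(i, j)\<close>.\<close>
        moreover have "1 - i \<noteq> i" using ij by presburger
        ultimately show ?thesis using box_a opp by auto
      next
        case False
        show ?thesis
        proof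
          assume "box z b p \<in> insert (i, j) R"
          then show False
            by (rule new[rotated -1])
              (use False p o ab z za zb min inj_f inj_g in \<open>auto simp: occ_def dest: inj_onD\<close>)
        qed
      qed
    qed (use ab z zb in auto)
    then show ?thesis by (auto simp: contains_def)
  qed
qed

lemma slot_cases:
  fixes x y b p :: int
  assumes "x < y" "y < b" "p \<noteq> x" "p \<noteq> y" "p \<noteq> b"
  obtains "p < x" | "x < p" "p < y" | "y < p" "p < b" | "b < p"
  using assms by linarith

text \<open>Let \<open>z\<close> be leftmost. Points above \<open>z\<close> between the columns of
  \<open>z\<close> and \<open>a\<close> would form 231 with \<open>z\<close> and \<open>a\<close>;
  points right of \<open>b\<close> between the heights of \<open>a\<close> and \<open>z\<close>
  would form 231 with \<open>z\<close> and \<open>b\<close>. All others that change cell land in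
  \<open>(1, 0)\<close>.\<close>

lemma contains_insert_01:
  assumes "contains R" "(1, 0) \<notin> R"
  shows "contains (insert (0, 1) R)"
proof (rule contains_insertI[OF assms(1), where h = "\<lambda>z. f z"], goal_cases)
  case new: (4 a b z p)
  have zz: "f z < f a" "g a < g z" using new(9-11,15) by auto
  have N: "\<not> (x \<in> P \<and> y \<in> P \<and> w \<in> P \<and> f x < f y \<and> f y < f w \<and> g w < g x \<and> g x < g y)" for x y w
    using no_231[of x y w] by auto
  show False
    \<comment> \<open>The coordinates of \<open>z\<close>, \<open>a\<close> and \<open>b\<close> cut
      the plane into four columns and four rows, so \<open>p\<close> has sixteen possible places.
      Each is settled by the boxes, by the choice of \<open>z\<close>, or by one of six triples that
      would form 231.\<close>
    by (rule slot_cases[OF zz(1) new(5) new(14,12,13)]; rule slot_cases[OF zz(2) new(8) new(16,18,17)];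
      use new(19-) N[of z p a] N[of p z a] N[of a p z] N[of a z p] N[of a b p] N[of z b p] zz new(1-8)
        assms(2-) in \<open>simp add: box_def third_def\<close>)
qed (use assms(2-) in simp_all)

text \<open>With \<open>z\<close> rightmost, points between the columns of \<open>a\<close> and
  \<open>z\<close> move to column 0. Those above \<open>a\<close> would form 231 with
  \<open>a\<close> and \<open>z\<close>, so only \<open>(0, 0)\<close> and \<open>(0, 1)\<close>
  gain points.\<close>

lemma contains_insert_10_right:
  assumes "contains R" "(0, 0) \<notin> R" "(0, 1) \<notin> R"
  shows "contains (insert (1, 0) R)"
proof (rule contains_insertI[OF assms(1), where h = "\<lambda>z. - f z"], goal_cases)
  case new: (4 a b z p)
  have zz: "f a < f z" "g z < g a" using new(9-11,15) by auto
  have N: "\<not> (x \<in> P \<and> y \<in> P \<and> w \<in> P \<and> f x < f y \<and> f y < f w \<and> g w < g x \<and> g x < g y)" for x y w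
    using no_231[of x y w] by auto
  show False
    by (rule slot_cases[OF zz(1) new(7) new(12,14,13)]; rule slot_cases[OF zz(2) new(6) new(18,16,17)];
      use new(19-) N[of z p a] N[of p z a] N[of a p z] N[of a z p] N[of a b p] N[of z b p] zz new(1-8)
        assms(2-) in \<open>simp add: box_def third_def\<close>)
qed (use assms(2-) in simp_all)

text \<open>With \<open>z\<close> lowest, \<open>(0, 0)\<close> gains nothing; instead, points of
  the old cell to the right of \<open>z\<close> enter \<open>(1, 1)\<close>.\<close>

lemma contains_insert_10_low:
  assumes "contains R" "(0, 1) \<notin> R" "(1, 1) \<notin> R"
  shows "contains (insert (1, 0) R)"
proof (rule contains_insertI[OF assms(1), where h = "\<lambda>z. g z"], goal_cases)
  case new: (4 a b z p)
  have zz: "f a < f z" "g z < g a" using new(9-11,15) by auto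
  have N: "\<not> (x \<in> P \<and> y \<in> P \<and> w \<in> P \<and> f x < f y \<and> f y < f w \<and> g w < g x \<and> g x < g y)" for x y w
    using no_231[of x y w] by auto
  show False
    by (rule slot_cases[OF zz(1) new(7) new(12,14,13)]; rule slot_cases[OF zz(2) new(6) new(18,16,17)];
      use new(19-) N[of z p a] N[of p z a] N[of a p z] N[of a z p] N[of a b p] N[of z b p] zz new(1-8)
        assms(2-) in \<open>simp add: box_def third_def\<close>)
qed (use assms(2-) in simp_all)

text \<open>With \<open>z\<close> rightmost, \<open>(0, 0)\<close> and \<open>(0, 1)\<close> can
  gain points. So can \<open>(0, 2)\<close>, but only from \<open>(1, 2)\<close>, whence the
  disjunction.\<close>

lemma contains_insert_11:
  assumes "contains R" "(0, 0) \<notin> R" "(0, 1) \<notin> R" "(1, 2) \<in> R \<or> (0, 2) \<notin> R"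
  shows "contains (insert (1, 1) R)"
proof (rule contains_insertI[OF assms(1), where h = "\<lambda>z. - f z"], goal_cases)
  case new: (4 a b z p)
  have zz: "f a < f z" "g a < g z" using new(9-11,15) by auto
  have N: "\<not> (x \<in> P \<and> y \<in> P \<and> w \<in> P \<and> f x < f y \<and> f y < f w \<and> g w < g x \<and> g x < g y)" for x y w
    using no_231[of x y w] by auto
  show False
    by (rule slot_cases[OF zz(1) new(7) new(12,14,13)]; rule slot_cases[OF zz(2) new(8) new(16,18,17)];
      use new(19-) N[of z p a] N[of p z a] N[of a p z] N[of a z p] N[of a b p] N[of z b p] zz new(1-8)
        assms(2-) in \<open>simp add: box_def third_def\<close>)
qed (use assms(2-) in simp_all)

text \<open>With \<open>z\<close> lowest, \<open>(0, 1)\<close> and \<open>(1, 1)\<close> can gain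
  points. So can \<open>(1, 2)\<close>, but only from \<open>(0, 2)\<close>, whence the
  disjunction.\<close>

lemma contains_insert_00:
  assumes "contains R" "(0, 1) \<notin> R" "(1, 1) \<notin> R" "(0, 2) \<in> R \<or> (1, 2) \<notin> R"
  shows "contains (insert (0, 0) R)"
proof (rule contains_insertI[OF assms(1), where h = "\<lambda>z. g z"], goal_cases)
  case new: (4 a b z p)
  have zz: "f z < f a" "g z < g a" using new(9-11,15) by auto
  have N: "\<not> (x \<in> P \<and> y \<in> P \<and> w \<in> P \<and> f x < f y \<and> f y < f w \<and> g w < g x \<and> g x < g y)" for x y w
    using no_231[of x y w] by auto
  show False
    by (rule slot_cases[OF zz(1) new(5) new(14,12,13)]; rule slot_cases[OF zz(2) new(6) new(18,16,17)];
      use new(19-) N[of z p a] N[of p z a] N[of a p z] N[of a z p] N[of a b p] N[of z b p] zz new(1-8)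
        assms(2-) in \<open>simp add: box_def third_def\<close>)
qed (use assms(2-) in simp_all)

end

section \<open>Mirroring at the antidiagonal\<close>

definition grid :: "(nat \<times> nat) set" where
  "grid = {0..2} \<times> {0..2}"

definition mir :: "nat \<times> nat \<Rightarrow> nat \<times> nat" where
  "mir c = (2 - snd c, 2 - fst c)"

lemma mir_in_grid: "mir c \<in> grid"
  by (auto simp: mir_def grid_def)

lemma mir_mir: "c \<in> grid \<Longrightarrow> mir (mir c) = c"
  by (auto simp: mir_def grid_def)

lemma third_le_2: "third a b x \<le> 2"
  by (simp add: third_def)

text \<open>The intervals in \<open>third\<close> are half-open, so the identity fails at the
  endpoints.\<close>

lemma third_minus:
  fixes a b x :: int
  assumes "a < b" "x \<noteq> a" "x \<noteq> b"
  shows "third (- b) (- a) (- x) = 2 - third a b x"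
  using assms by (auto simp: third_def)

text \<open>The reflection exchanges the first two points of a 231 and keeps the last one last, so
  231 is its own mirror image.\<close>

lemma avoids_231_mirror: "avoids_231 P f g \<Longrightarrow> avoids_231 P (\<lambda>x. - g x) (\<lambda>x. - f x)"
  unfolding avoids_231_def by (auto simp: inj_on_def)

context avoids_231
begin

interpretation mirror: avoids_231 P "\<lambda>x. - g x" "\<lambda>x. - f x"
  by (rule avoids_231_mirror) (rule avoids_231_axioms)

lemma box_in_grid: "box a b p \<in> grid"
  by (simp add: box_def grid_def third_le_2)

lemma mirror_box:
  assumes "a \<in> P" "b \<in> P" "p \<in> P - {a, b}" "f a < f b" "g a < g b"
  shows "mirror.box b a p = mir (box a b p)"
proof -
  have "f p \<noteq> f a" "f p \<noteq> f b" "g p \<noteq> g a" "g p \<noteq> g b"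
    using assms inj_f inj_g by (auto dest: inj_onD)
  then show ?thesis
    using assms by (simp add: mirror.box_def box_def mir_def third_minus)
qed

text \<open>Negation reverses both orders, so \<open>b\<close> becomes the lower left point of the
  mirrored occurrence.\<close>

lemma mirror_occ:
  assumes "R \<subseteq> grid"
  shows "mirror.occ (mir ` R) b a \<longleftrightarrow> occ R a b"
proof -
  have mem: "mir c \<in> mir ` R \<longleftrightarrow> c \<in> R" if "c \<in> grid" for c
    using assms that mir_mir by (metis imageE imageI subsetD)
  have "(\<forall>p \<in> P - {b, a}. mirror.box b a p \<notin> mir ` R) \<longleftrightarrow> (\<forall>p \<in> P - {a, b}. box a b p \<notin> R)"
    if "a \<in> P" "b \<in> P" "f a < f b" "g a < g b"
    unfolding insert_commute[of b a]
    by (intro ball_cong refl) (simp only: mirror_box[OF that(1,2) _ that(3,4)] mem[OF box_in_grid])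
  then show ?thesis
    by (auto simp only: mirror.occ_def occ_def neg_less_iff_less)
qed

lemma mirror_contains: "R \<subseteq> grid \<Longrightarrow> mirror.contains (mir ` R) \<longleftrightarrow> contains R"
  by (auto simp: mirror.contains_def contains_def mirror_occ)

text \<open>A point in \<open>(2, 0)\<close> would form 231 with \<open>a\<close> and
  \<open>b\<close>, so this cell is empty for every occurrence.\<close>

lemma contains_insert_20:
  assumes "contains R"
  shows "contains (insert (2, 0) R)"
proof -
  obtain a b where o: "occ R a b" using assms by (auto simp: contains_def)
  have "box a b p \<noteq> (2, 0)" if p: "p \<in> P - {a, b}" for p
  proof
    assume "box a b p = (2, 0)"
    then have "f b \<le> f p" "g p < g a"
      by (simp_all add: box_def third_def not_less split: if_splits)
    moreover have "f b \<noteq> f p"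
      using p o inj_f by (auto simp: occ_def dest: inj_onD)
    ultimately show False
      using no_231[of a b p] p o by (simp add: occ_def)
  qed
  then have "occ (insert (2, 0) R) a b" using o by (auto simp: occ_def)
  then show ?thesis by (auto simp: contains_def)
qed

end

text \<open>The two rules for \<open>(1, 0)\<close> are merged. No condition for \<open>c\<close>
  asks whether \<open>c\<close> itself is in \<open>R\<close>, so each rule can remove a shading as
  well as add one.\<close>

definition addable1 :: "nat \<times> nat \<Rightarrow> (nat \<times> nat) set \<Rightarrow> bool" where
  "addable1 c R \<longleftrightarrow>
     c = (2, 0) \<or>
     c = (0, 1) \<and> (1, 0) \<notin> R \<or>
     c = (1, 0) \<and> (0, 1) \<notin> R \<and> ((0, 0) \<notin> R \<or> (1, 1) \<notin> R) \<or>
     c = (1, 1) \<and> (0, 0) \<notin> R \<and> (0, 1) \<notin> R \<and> ((1, 2) \<in> R \<or> (0, 2) \<notin> R) \<or>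
     c = (0, 0) \<and> (0, 1) \<notin> R \<and> (1, 1) \<notin> R \<and> ((0, 2) \<in> R \<or> (1, 2) \<notin> R)"

definition addable :: "nat \<times> nat \<Rightarrow> (nat \<times> nat) set \<Rightarrow> bool" where
  "addable c R \<longleftrightarrow> addable1 c R \<or> addable1 (mir c) (mir ` R)"

lemma (in avoids_231) contains_insert_addable1:
  "addable1 c R \<Longrightarrow> contains R \<Longrightarrow> contains (insert c R)"
  unfolding addable1_def
  using contains_insert_20 contains_insert_01 contains_insert_10_right contains_insert_10_low
    contains_insert_11 contains_insert_00
  by blast

lemma (in avoids_231) contains_insert_addable:
  assumes "addable c R" "R \<subseteq> grid" "c \<in> grid"
  shows "contains (insert c R) \<longleftrightarrow> contains R"
proof
  assume R: "contains R"
  interpret mirror: avoids_231 P "\<lambda>x. - g x" "\<lambda>x. - f x"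
    by (rule avoids_231_mirror) (rule avoids_231_axioms)
  consider "addable1 c R" | "addable1 (mir c) (mir ` R)"
    using assms(1) by (auto simp: addable_def)
  then show "contains (insert c R)"
  proof cases
    case 1
    then show ?thesis using R by (rule contains_insert_addable1)
  next
    case 2
    then have "mirror.contains (mir ` insert c R)"
      using mirror.contains_insert_addable1 R mirror_contains assms(2) by simp
    then show ?thesis using mirror_contains[of "insert c R"] assms(2,3) by simp
  qed
qed (auto intro: contains_subset)


section \<open>Normal forms\<close>

text \<open>Shadings are encoded as nine bits for evaluation; cell \<open>(i, j)\<close> is bit \<open>3 * i + j\<close>.\<close>

definition cells :: "bool list \<Rightarrow> (nat \<times> nat) set" where
  "cells bs = {(i, j). i < 3 \<and> j < 3 \<and> bs ! (3 * i + j)}"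

text \<open>This is \<open>addable\<close> in bits. The mirror exchanges bits 0 and 8, 1 and 5, 3
  and 7. The centre, bit 4, has a rule and its mirror image; bit 2, cell \<open>(0, 2)\<close>, has
  no rule.\<close>

definition addable_bit :: "nat \<Rightarrow> bool list \<Rightarrow> bool" where
  "addable_bit k b \<longleftrightarrow>
     k = 0 \<and> \<not> b ! 1 \<and> \<not> b ! 4 \<and> (b ! 2 \<or> \<not> b ! 5) \<or>
     k = 1 \<and> \<not> b ! 3 \<or>
     k = 3 \<and> \<not> b ! 1 \<and> (\<not> b ! 0 \<or> \<not> b ! 4) \<or>
     k = 4 \<and> (\<not> b ! 0 \<and> \<not> b ! 1 \<and> (b ! 5 \<or> \<not> b ! 2) \<or> \<not> b ! 8 \<and> \<not> b ! 5 \<and> (b ! 1 \<or> \<not> b ! 2)) \<or>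
     k = 5 \<and> \<not> b ! 7 \<or>
     k = 6 \<or>
     k = 7 \<and> \<not> b ! 5 \<and> (\<not> b ! 8 \<or> \<not> b ! 4) \<or>
     k = 8 \<and> \<not> b ! 5 \<and> \<not> b ! 4 \<and> (b ! 2 \<or> \<not> b ! 1)"

text \<open>An inapplicable step leaves the shading alone, so one fixed sequence of steps can be run
  on every shading.\<close>

definition toggle :: "nat \<times> bool \<Rightarrow> bool list \<Rightarrow> bool list" where
  "toggle m b = (if addable_bit (fst m) b then b[fst m := snd m] else b)"

lemma length_toggle [simp]: "length (toggle m b) = length b"
  by (simp add: toggle_def)

lemma cells_subset_grid: "cells b \<subseteq> grid"
  by (auto simp: cells_def grid_def)

lemma cells_update:
  assumes "length b = 9" "k < 9"
  shows "cells (b[k := v]) =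
    (if v then insert (k div 3, k mod 3) (cells b) else cells b - {(k div 3, k mod 3)})"
proof -
  have "3 * i + j = k \<longleftrightarrow> i = k div 3 \<and> j = k mod 3" if "j < 3" for i j
    using that by auto
  moreover have "k div 3 < 3" "k mod 3 < 3" using assms(2) by auto
  ultimately show ?thesis
    using assms by (auto simp: cells_def nth_list_update)
qed

lemma addable_cells:
  assumes "addable_bit k b" "k < 9"
  shows "addable (k div 3, k mod 3) (cells b - {(k div 3, k mod 3)})"
proof -
  have mir_pair: "mir (i, j) = (2 - j, 2 - i)" for i j
    by (simp add: mir_def)
  have mem_mir: "(i, j) \<in> mir ` (cells b - {c}) \<longleftrightarrow>
      i \<le> 2 \<and> j \<le> 2 \<and> (2 - j, 2 - i) \<in> cells b \<and> (2 - j, 2 - i) \<noteq> c" for i j c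
  proof
    assume "i \<le> 2 \<and> j \<le> 2 \<and> (2 - j, 2 - i) \<in> cells b \<and> (2 - j, 2 - i) \<noteq> c"
    then show "(i, j) \<in> mir ` (cells b - {c})"
      by (intro image_eqI[of _ _ "(2 - j, 2 - i)"]) (auto simp: mir_pair)
  qed (auto simp: mir_pair cells_def)
  have "k \<in> {0, 1, 2, 3, 4, 5, 6, 7, 8}" using assms(2) by auto
  then show ?thesis
    using assms(1)
    by (elim insertE emptyE; simp add: addable_bit_def addable_def addable1_def mem_mir mir_pair; simp add: cells_def; blast?)
qed

lemma (in avoids_231) contains_toggle:
  assumes "length b = 9" "fst m < 9"
  shows "contains (cells (toggle m b)) \<longleftrightarrow> contains (cells b)"
proof (cases "addable_bit (fst m) b")
  case True
  let ?c = "(fst m div 3, fst m mod 3)" let ?S = "cells b - {?c}"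
  have c: "?c \<in> grid" using assms(2) by (auto simp: grid_def)
  have eq: "contains (insert ?c ?S) \<longleftrightarrow> contains ?S"
    by (rule contains_insert_addable)
      (use addable_cells True assms(2) cells_subset_grid c in auto)
  have "cells (toggle m b) = (if snd m then insert ?c ?S else ?S)"
    using True assms by (simp add: toggle_def cells_update)
  \<comment> \<open>Whatever the old and new value of the bit, both shadings are among the two that
    \<open>eq\<close> compares.\<close>
  moreover have "cells b = insert ?c ?S \<or> cells b = ?S" by auto
  ultimately show ?thesis using eq by (cases "snd m") (metis (full_types))+
qed (simp add: toggle_def)

lemma (in avoids_231) contains_fold_toggle:
  assumes "length b = 9" "\<forall>m \<in> set ms. fst m < 9"
  shows "contains (cells (fold toggle ms b)) \<longleftrightarrow> contains (cells b)"
  using assms by (induction ms arbitrary: b) (simp_all add: contains_toggle)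

section \<open>Words\<close>

definition occ12 :: "nat list \<Rightarrow> (nat \<times> nat) set \<Rightarrow> nat \<Rightarrow> nat \<Rightarrow> bool" where
  "occ12 \<pi> R i j \<longleftrightarrow> i < j \<and> j < length \<pi> \<and> \<pi> ! i < \<pi> ! j \<and>
     (\<forall>k < length \<pi>. k \<noteq> i \<longrightarrow> k \<noteq> j \<longrightarrow> (third i j k, third (\<pi> ! i) (\<pi> ! j) (\<pi> ! k)) \<notin> R)"

lemma is_perm_iff: "is_perm \<pi> \<longleftrightarrow> distinct \<pi> \<and> set \<pi> = {1..length \<pi>}"
  by (auto simp: is_perm_def permutations_of_set_def)

lemma plot_eq: "plot \<pi> = (\<lambda>k. (k + 1, \<pi> ! k)) ` {..<length \<pi>}"
proof -
  have "{1..length \<pi>} = Suc ` {..<length \<pi>}"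
    by (simp add: image_Suc_lessThan)
  then show ?thesis by (auto simp: plot_def)
qed

lemma plot_12: "plot [1, 2] = {(1, 1), (2, 2)}"
  by (simp add: plot_eq lessThan_Suc insert_commute numeral_2_eq_2)

lemma plot_231: "plot [2, 3, 1] = {(1, 2), (2, 3), (3, 1)}"
  by (simp add: plot_eq lessThan_Suc insert_commute numeral_3_eq_3 numeral_2_eq_2)

lemma Collect_pairs_eq_image: "{(\<alpha> i, \<beta> j) | i j. (i, j) \<in> S} = map_prod \<alpha> \<beta> ` S"
  by force

lemma occurrenceI:
  assumes "\<omega> = map_prod \<alpha> \<beta> ` plot (fst p)" "\<omega> \<subseteq> plot \<pi>"
    and "bordered_embedding (length (fst p)) (length \<pi>) \<alpha>"
    and "bordered_embedding (length (fst p)) (length \<pi>) \<beta>"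
    and "\<And>u v. (u, v) \<in> snd p \<Longrightarrow> cell \<alpha> \<beta> u v \<inter> plot \<pi> = {}"
  shows "occurrence p \<pi> \<omega>"
  using assms unfolding occurrence_def Collect_pairs_eq_image by blast

lemma bordered_embedding_2:
  "bordered_embedding 2 n \<alpha> \<longleftrightarrow>
     \<alpha> 0 = 0 \<and> 1 \<le> \<alpha> 1 \<and> \<alpha> 1 < \<alpha> 2 \<and> \<alpha> 2 \<le> n \<and> \<alpha> 3 = n + 1"
proof -
  have "{1..2::nat} = {1, 2}" by auto
  then show ?thesis
    by (auto simp: bordered_embedding_def strict_mono_on_def)
qed

lemma bordered_embedding_3:
  "bordered_embedding 3 n \<alpha> \<longleftrightarrow>
     \<alpha> 0 = 0 \<and> 1 \<le> \<alpha> 1 \<and> \<alpha> 1 < \<alpha> 2 \<and> \<alpha> 2 < \<alpha> 3 \<and> \<alpha> 3 \<le> n \<and> \<alpha> 4 = n + 1"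
proof -
  have "{1..3::nat} = {1, 2, 3}" by auto
  then show ?thesis
    by (auto simp: bordered_embedding_def strict_mono_on_def)
qed

section \<open>Occurrences of 12 in words\<close>

lemma strip_iff_third:
  assumes "bordered_embedding 2 n \<alpha>" "1 \<le> x" "x \<le> n" "u \<le> 2"
  shows "x \<in> {\<alpha> u + 1..\<alpha> (u + 1) - 1} \<longleftrightarrow> x \<noteq> \<alpha> 1 \<and> x \<noteq> \<alpha> 2 \<and> u = third (\<alpha> 1) (\<alpha> 2) x"
proof -
  have "u = 0 \<or> u = 1 \<or> u = 2" using assms(4) by auto
  then show ?thesis
    using assms(1-3) unfolding bordered_embedding_2
    by (elim disjE) (auto simp: third_def numeral_2_eq_2 numeral_3_eq_3)
qed

text \<open>Entries are distinct, so a point outside the occurrence lies on no grid line. Positions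
  count from 0 and columns of the plot from 1; \<open>third\<close> is invariant under this
  shift.\<close>

lemma cell_iff_third:
  assumes \<pi>: "is_perm \<pi>" and ij: "i < j" "j < length \<pi>" "k < length \<pi>" and uv: "u \<le> 2" "v \<le> 2"
    and \<alpha>: "bordered_embedding 2 (length \<pi>) \<alpha>" "\<alpha> 1 = i + 1" "\<alpha> 2 = j + 1"
    and \<beta>: "bordered_embedding 2 (length \<pi>) \<beta>" "\<beta> 1 = \<pi> ! i" "\<beta> 2 = \<pi> ! j"
  shows "(k + 1, \<pi> ! k) \<in> cell \<alpha> \<beta> u v \<longleftrightarrow>
    k \<noteq> i \<and> k \<noteq> j \<and> (u, v) = (third i j k, third (\<pi> ! i) (\<pi> ! j) (\<pi> ! k))"
proof -
  have k: "1 \<le> \<pi> ! k" "\<pi> ! k \<le> length \<pi>"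
    using \<pi> nth_mem[OF ij(3)] by (auto simp: is_perm_iff)
  have "\<pi> ! k \<noteq> \<pi> ! i" "\<pi> ! k \<noteq> \<pi> ! j" if "k \<noteq> i" "k \<noteq> j"
    using \<pi> ij that by (auto simp: is_perm_iff nth_eq_iff_index_eq)
  moreover have "third (i + 1) (j + 1) (k + 1) = third i j k"
    by (simp add: third_def)
  ultimately show ?thesis
    using strip_iff_third[OF \<alpha>(1) _ _ uv(1), of "k + 1"] strip_iff_third[OF \<beta>(1) k uv(2)] ij(3)
    unfolding cell_def mem_Times_iff fst_conv snd_conv \<alpha>(2,3) \<beta>(2,3) by auto
qed

lemma occurrence_12_iff:
  assumes \<pi>: "is_perm \<pi>" and R: "R \<subseteq> grid"
  shows "(\<exists>\<omega>. occurrence ([1, 2], R) \<pi> \<omega>) \<longleftrightarrow> (\<exists>i j. occ12 \<pi> R i j)"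
proof
  assume "\<exists>\<omega>. occurrence ([1, 2], R) \<pi> \<omega>"
  then obtain \<omega> \<alpha> \<beta> where sub: "\<omega> \<subseteq> plot \<pi>"
    and \<alpha>: "bordered_embedding 2 (length \<pi>) \<alpha>" and \<beta>: "bordered_embedding 2 (length \<pi>) \<beta>"
    and \<omega>: "\<omega> = {(\<alpha> i, \<beta> j) | i j. (i, j) \<in> plot [1, 2]}"
    and empty: "\<forall>(u, v) \<in> R. cell \<alpha> \<beta> u v \<inter> plot \<pi> = {}"
    by (auto simp: occurrence_def numeral_2_eq_2)
  have "(\<alpha> 1, \<beta> 1) \<in> plot \<pi>" "(\<alpha> 2, \<beta> 2) \<in> plot \<pi>"
    using sub unfolding \<omega> Collect_pairs_eq_image plot_12 by auto
  then obtain i j where i: "i < length \<pi>" "\<alpha> 1 = i + 1" "\<beta> 1 = \<pi> ! i"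
    and j: "j < length \<pi>" "\<alpha> 2 = j + 1" "\<beta> 2 = \<pi> ! j"
    unfolding plot_eq by auto
  have ij: "i < j" "\<pi> ! i < \<pi> ! j"
    using \<alpha> \<beta> i j by (auto simp: bordered_embedding_2)
  have "(third i j k, third (\<pi> ! i) (\<pi> ! j) (\<pi> ! k)) \<notin> R" (is "(?u, ?v) \<notin> R")
    if k: "k < length \<pi>" "k \<noteq> i" "k \<noteq> j" for k
  proof
    assume "(?u, ?v) \<in> R"
    then have "cell \<alpha> \<beta> ?u ?v \<inter> plot \<pi> = {}" using empty by auto
    moreover have "(k + 1, \<pi> ! k) \<in> cell \<alpha> \<beta> ?u ?v"
      by (subst cell_iff_third[OF \<pi> ij(1) j(1) k(1) third_le_2 third_le_2 \<alpha> i(2) j(2) \<beta> i(3) j(3)])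
        (use k in auto)
    moreover have "(k + 1, \<pi> ! k) \<in> plot \<pi>" using k unfolding plot_eq by auto
    ultimately show False by blast
  qed
  then show "\<exists>i j. occ12 \<pi> R i j" using ij j by (auto simp: occ12_def)
next
  assume "\<exists>i j. occ12 \<pi> R i j"
  then obtain i j where ij: "i < j" "j < length \<pi>" "\<pi> ! i < \<pi> ! j"
    and empty: "\<And>k. \<lbrakk>k < length \<pi>; k \<noteq> i; k \<noteq> j\<rbrakk> \<Longrightarrow>
      (third i j k, third (\<pi> ! i) (\<pi> ! j) (\<pi> ! k)) \<notin> R"
    by (auto simp: occ12_def)
  let ?n = "length \<pi>"
  \<comment> \<open>The default value provides the upper border, which is the value at 3.\<close>
  let ?e = "\<lambda>x y. (\<lambda>_. ?n + 1)(0 := 0, 1 := x, 2 := y :: nat)"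
  have "\<pi> ! i \<in> {1..?n}" "\<pi> ! j \<in> {1..?n}"
    using \<pi> ij nth_mem[of i \<pi>] nth_mem[of j \<pi>] unfolding is_perm_iff by auto
  then have emb: "bordered_embedding 2 ?n (?e (i + 1) (j + 1))"
    "bordered_embedding 2 ?n (?e (\<pi> ! i) (\<pi> ! j))"
    using ij by (auto simp: bordered_embedding_2)
  have empty_cell: "cell (?e (i + 1) (j + 1)) (?e (\<pi> ! i) (\<pi> ! j)) u v \<inter> plot \<pi> = {}"
    if uv: "(u, v) \<in> R" for u v
  proof -
    have le: "u \<le> 2" "v \<le> 2" using R uv by (auto simp: grid_def)
    have "(k + 1, \<pi> ! k) \<notin> cell (?e (i + 1) (j + 1)) (?e (\<pi> ! i) (\<pi> ! j)) u v" if "k < ?n" for k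
      by (subst cell_iff_third[OF \<pi> ij(1,2) that le emb(1) _ _ emb(2)])
        (use uv empty[OF that] in auto)
    then show ?thesis unfolding plot_eq by blast
  qed
  have length_12: "length [1, 2 :: nat] = 2" by simp
  have "occurrence ([1, 2], R) \<pi> {(i + 1, \<pi> ! i), (j + 1, \<pi> ! j)}"
  proof (rule occurrenceI[OF _ _ _ _ empty_cell])
    show "{(i + 1, \<pi> ! i), (j + 1, \<pi> ! j)} \<subseteq> plot \<pi>"
      using ij unfolding plot_eq by auto
    show "{(i + 1, \<pi> ! i), (j + 1, \<pi> ! j)} =
      map_prod (?e (i + 1) (j + 1)) (?e (\<pi> ! i) (\<pi> ! j)) ` plot (fst ([1, 2], R))"
      unfolding fst_conv plot_12 by simp
  qed (use emb in \<open>simp_all only: fst_conv snd_conv length_12\<close>)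
  then show "\<exists>\<omega>. occurrence ([1, 2], R) \<pi> \<omega>" by blast
qed

section \<open>Occurrences of 231 in words\<close>

definition has_231 :: "nat list \<Rightarrow> bool" where
  "has_231 \<pi> \<longleftrightarrow> (\<exists>k \<in> set [0..<length \<pi>]. \<exists>j \<in> set [0..<k]. \<exists>i \<in> set [0..<j].
     \<pi> ! k < \<pi> ! i \<and> \<pi> ! i < \<pi> ! j)"

lemma avoids_231_iff:
  assumes \<pi>: "is_perm \<pi>"
  shows "avoids \<pi> (classical [2, 3, 1]) \<longleftrightarrow> \<not> has_231 \<pi>"
proof -
  have "(\<exists>\<omega>. occurrence (classical [2, 3, 1]) \<pi> \<omega>) \<longleftrightarrow> has_231 \<pi>"
  proof
    assume "\<exists>\<omega>. occurrence (classical [2, 3, 1]) \<pi> \<omega>"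
    then obtain \<omega> \<alpha> \<beta> where sub: "\<omega> \<subseteq> plot \<pi>"
      and \<alpha>: "bordered_embedding 3 (length \<pi>) \<alpha>" and \<beta>: "bordered_embedding 3 (length \<pi>) \<beta>"
      and \<omega>: "\<omega> = {(\<alpha> i, \<beta> j) | i j. (i, j) \<in> plot [2, 3, 1]}"
      by (auto simp: occurrence_def classical_def numeral_3_eq_3)
    have "(\<alpha> 1, \<beta> 2) \<in> plot \<pi>" "(\<alpha> 2, \<beta> 3) \<in> plot \<pi>" "(\<alpha> 3, \<beta> 1) \<in> plot \<pi>"
      using sub unfolding \<omega> Collect_pairs_eq_image plot_231 by auto
    then obtain i j k where "\<alpha> 1 = i + 1" "\<beta> 2 = \<pi> ! i" "\<alpha> 2 = j + 1" "\<beta> 3 = \<pi> ! j"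
      "k < length \<pi>" "\<alpha> 3 = k + 1" "\<beta> 1 = \<pi> ! k"
      unfolding plot_eq by auto
    with \<alpha> \<beta> have "k < length \<pi>" "j < k" "i < j" "\<pi> ! k < \<pi> ! i" "\<pi> ! i < \<pi> ! j"
      by (auto simp: bordered_embedding_3)
    then show "has_231 \<pi>" unfolding has_231_def
      by (intro bexI[of _ k] bexI[of _ j] bexI[of _ i]) auto
  next
    assume "has_231 \<pi>"
    then obtain i j k where ijk: "i < j" "j < k" "k < length \<pi>" "\<pi> ! k < \<pi> ! i" "\<pi> ! i < \<pi> ! j"
      by (auto simp: has_231_def)
    let ?n = "length \<pi>"
    let ?e = "\<lambda>x y z. (\<lambda>_. ?n + 1)(0 := 0, 1 := x, 2 := y, 3 := z :: nat)"
    have "\<pi> ! k \<in> {1..?n}" "\<pi> ! j \<in> {1..?n}"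
      using \<pi> ijk nth_mem[of k \<pi>] nth_mem[of j \<pi>] unfolding is_perm_iff by auto
    \<comment> \<open>The second embedding lists the values in increasing order, hence the order
      \<open>k\<close>, \<open>i\<close>, \<open>j\<close>.\<close>
    then have emb: "bordered_embedding 3 ?n (?e (i + 1) (j + 1) (k + 1))"
      "bordered_embedding 3 ?n (?e (\<pi> ! k) (\<pi> ! i) (\<pi> ! j))"
      using ijk by (auto simp: bordered_embedding_3)
    have length_231: "length [2, 3, 1 :: nat] = 3" by simp
    have "occurrence (classical [2, 3, 1]) \<pi> {(i + 1, \<pi> ! i), (j + 1, \<pi> ! j), (k + 1, \<pi> ! k)}"
    proof (rule occurrenceI[where \<alpha> = "?e (i + 1) (j + 1) (k + 1)" and \<beta> = "?e (\<pi> ! k) (\<pi> ! i) (\<pi> ! j)"])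
      show "{(i + 1, \<pi> ! i), (j + 1, \<pi> ! j), (k + 1, \<pi> ! k)} \<subseteq> plot \<pi>"
        using ijk unfolding plot_eq by auto
      show "{(i + 1, \<pi> ! i), (j + 1, \<pi> ! j), (k + 1, \<pi> ! k)} =
        map_prod (?e (i + 1) (j + 1) (k + 1)) (?e (\<pi> ! k) (\<pi> ! i) (\<pi> ! j)) ` plot (fst (classical [2, 3, 1]))"
        unfolding fst_conv classical_def plot_231 by simp
    qed (use emb in \<open>simp_all only: classical_def fst_conv snd_conv length_231 empty_iff\<close>)
    then show "\<exists>\<omega>. occurrence (classical [2, 3, 1]) \<pi> \<omega>" by blast
  qed
  then show ?thesis by (simp add: avoids_def)
qed

section \<open>Words as instances of the abstract setting\<close>

lemma avoids_231_word:
  assumes "is_perm \<pi>" "\<not> has_231 \<pi>"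
  shows "avoids_231 {..<length \<pi>} int (\<lambda>i. int (\<pi> ! i))"
proof
  show "inj_on (\<lambda>i. int (\<pi> ! i)) {..<length \<pi>}"
    using assms(1) by (auto simp: is_perm_iff inj_on_def nth_eq_iff_index_eq)
next
  fix x y z
  assume "x \<in> {..<length \<pi>}" "y \<in> {..<length \<pi>}" "z \<in> {..<length \<pi>}" "int x < int y" "int y < int z"
    "int (\<pi> ! z) < int (\<pi> ! x)" "int (\<pi> ! x) < int (\<pi> ! y)"
  then show False using assms(2) by (auto simp: has_231_def)
qed auto

lemma contains_word_iff:
  assumes "is_perm \<pi>" "\<not> has_231 \<pi>"
  shows "avoids_231.contains {..<length \<pi>} int (\<lambda>i. int (\<pi> ! i)) R \<longleftrightarrow> (\<exists>i j. occ12 \<pi> R i j)"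
proof -
  interpret avoids_231 "{..<length \<pi>}" int "\<lambda>i. int (\<pi> ! i)"
    using assms by (rule avoids_231_word)
  have "third (int a) (int b) (int x) = third a b x" for a b x
    by (simp add: third_def)
  then have "occ R i j \<longleftrightarrow> occ12 \<pi> R i j" for i j
    by (auto simp: occ_def occ12_def box_def)
  then show ?thesis by (simp add: contains_def)
qed

definition Av_12 :: "(nat \<times> nat) set \<Rightarrow> nat list set" where
  "Av_12 R = Av {classical [2, 3, 1], ([1, 2], R)}"

lemma mem_Av_12:
  assumes "R \<subseteq> grid"
  shows "\<pi> \<in> Av_12 R \<longleftrightarrow> is_perm \<pi> \<and> \<not> has_231 \<pi> \<and> (\<nexists>i j. occ12 \<pi> R i j)"
  using avoids_231_iff[of \<pi>] occurrence_12_iff[OF _ assms, of \<pi>]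
  by (auto simp: Av_12_def Av_def avoids_def)

lemma Av_12_fold_toggle:
  assumes "length b = 9" "\<forall>m \<in> set ms. fst m < 9"
  shows "Av_12 (cells (fold toggle ms b)) = Av_12 (cells b)"
proof -
  have "(\<exists>i j. occ12 \<pi> (cells (fold toggle ms b)) i j) \<longleftrightarrow> (\<exists>i j. occ12 \<pi> (cells b) i j)"
    if \<pi>: "is_perm \<pi>" "\<not> has_231 \<pi>" for \<pi>
    using avoids_231.contains_fold_toggle[OF avoids_231_word[OF \<pi>] assms]
    unfolding contains_word_iff[OF \<pi>] .
  then show ?thesis
    by (simp add: set_eq_iff mem_Av_12[OF cells_subset_grid]) blast
qed


section \<open>Computation\<close>

text \<open>Quantifiers range over lists, as in \<open>has_231\<close>, so that evaluation decides
  the predicate.\<close>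

definition word_contains :: "nat list \<Rightarrow> bool list \<Rightarrow> bool" where
  "word_contains \<pi> b \<longleftrightarrow>
     (\<exists>j \<in> set [0..<length \<pi>]. \<exists>i \<in> set [0..<j]. \<pi> ! i < \<pi> ! j \<and>
        (\<forall>k \<in> set [0..<length \<pi>]. k = i \<or> k = j \<or>
          \<not> b ! (3 * third i j k + third (\<pi> ! i) (\<pi> ! j) (\<pi> ! k))))"

lemma word_contains_iff: "word_contains \<pi> b \<longleftrightarrow> (\<exists>i j. occ12 \<pi> (cells b) i j)"
proof -
  have mem: "(third i j k, third x y z) \<in> cells b \<longleftrightarrow> b ! (3 * third i j k + third x y z)"
    for i j k x y z :: nat
    by (auto simp: cells_def third_def)
  have "occ12 \<pi> (cells b) i j \<longleftrightarrow> j \<in> set [0..<length \<pi>] \<and> i \<in> set [0..<j] \<and> \<pi> ! i < \<pi> ! j \<and>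
      (\<forall>k \<in> set [0..<length \<pi>]. k = i \<or> k = j \<or>
        \<not> b ! (3 * third i j k + third (\<pi> ! i) (\<pi> ! j) (\<pi> ! k)))" for i j
    unfolding occ12_def mem by auto
  then show ?thesis unfolding word_contains_def by blast
qed

text \<open>A greedy choice among the small permutations avoiding \<open>231\<close>.\<close>

definition separators :: "nat list list" where
  "separators = [[3,1,2], [1,3,2], [2,1,3], [1,2,3], [1,4,2,3], [3,1,2,4], [1,3,2,4],
     [2,1,3,5,4], [1,2,4,3], [2,1,3,4], [1,5,3,2,4], [4,1,3,2,5]]"

lemma separators:
  assumes "\<pi> \<in> set separators"
  shows "is_perm \<pi>" "\<not> has_231 \<pi>"
proof -
  have "\<forall>\<pi> \<in> set separators. distinct \<pi> \<and> set \<pi> = set [1..<Suc (length \<pi>)] \<and> \<not> has_231 \<pi>"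
    by code_simp
  then show "is_perm \<pi>" "\<not> has_231 \<pi>"
    using assms by (auto simp: is_perm_iff atLeastLessThanSuc_atLeastAtMost)
qed

definition signature :: "bool list \<Rightarrow> bool list" where
  "signature b = map (\<lambda>\<pi>. word_contains \<pi> b) separators"

text \<open>The separators avoid 231, and for such permutations containment is non-membership in
  \<open>Av_12\<close>. So the signature is an invariant of the avoidance class.\<close>

lemma signature_eqI:
  assumes "Av_12 (cells b) = Av_12 (cells b')"
  shows "signature b = signature b'"
  unfolding signature_def
proof (rule map_cong[OF refl])
  fix \<pi> assume "\<pi> \<in> set separators"
  then show "word_contains \<pi> b = word_contains \<pi> b'"
    using assms separators mem_Av_12[OF cells_subset_grid]
    unfolding word_contains_iff by blast
qed

text \<open>What remains after unshading bit 6, bit 1 where bit 3 is unshaded, and bit 5 where bit 7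
  is unshaded: 144 of the 512 shadings, which keeps the evaluation small.\<close>

definition reduced :: "bool list list" where
  "reduced = filter (\<lambda>b. \<not> b ! 6 \<and> (b ! 1 \<longrightarrow> b ! 3) \<and> (b ! 5 \<longrightarrow> b ! 7))
     (List.n_lists 9 [False, True])"

text \<open>This sequence of rule applications was found by a computer search: it merges all
  patterns of the same class.\<close>

definition moves :: "(nat \<times> bool) list" where
  "moves = [(4, False), (3, False), (7, False), (0, False), (5, True), (4, False), (5, False),
     (8, False), (0, True), (1, True), (4, False)]"

definition normal_forms :: "bool list list" where
  "normal_forms = remdups (map (fold toggle moves) reduced)"

text \<open>The length bounds the number of classes from above, the distinct signatures bound it
  from below.\<close>

lemma normal_forms_separated: "length normal_forms = 56 \<and> distinct (map signature normal_forms)"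
  by code_simp

lemma set_reduced:
  "set reduced = {b. length b = 9 \<and> \<not> b ! 6 \<and> (b ! 1 \<longrightarrow> b ! 3) \<and> (b ! 5 \<longrightarrow> b ! 7)}"
  by (auto simp: reduced_def set_n_lists)

lemma length_fold_toggle: "length (fold toggle ms b) = length b"
  by (induction ms arbitrary: b) simp_all

lemma nth_toggle:
  "k < length b \<Longrightarrow> toggle (k, v) b ! l = (if l = k \<and> addable_bit k b then v else b ! l)"
  by (simp add: toggle_def nth_list_update)

lemma Av_12_normal_forms:
  "(\<lambda>b. Av_12 (cells b)) ` {b. length b = 9} = (\<lambda>b. Av_12 (cells b)) ` set normal_forms"
proof
  show "(\<lambda>b. Av_12 (cells b)) ` {b. length b = 9} \<subseteq> (\<lambda>b. Av_12 (cells b)) ` set normal_forms"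
  proof clarify
    fix b :: "bool list" assume b: "length b = 9"
    have addable_simps: "addable_bit 6 a" "addable_bit (Suc 0) a \<longleftrightarrow> \<not> a ! 3"
      "addable_bit 5 a \<longleftrightarrow> \<not> a ! 7" for a
      by (simp_all add: addable_bit_def)
    \<comment> \<open>These three steps bring every shading into \<open>reduced\<close>.\<close>
    define b1 where "b1 = fold toggle [(6, False), (1, False), (5, False)] b"
    have "b1 \<in> set reduced"
      using b by (simp add: b1_def set_reduced nth_toggle addable_simps)
    then have "fold toggle moves b1 \<in> set normal_forms"
      by (simp add: normal_forms_def)
    moreover have "length b1 = 9" by (simp add: b1_def b)
    then have "Av_12 (cells (fold toggle moves b1)) = Av_12 (cells b1)"
      by (intro Av_12_fold_toggle) (simp_all add: moves_def)
    moreover have "Av_12 (cells b1) = Av_12 (cells b)"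
      unfolding b1_def by (intro Av_12_fold_toggle b) simp
    ultimately show "Av_12 (cells b) \<in> (\<lambda>b. Av_12 (cells b)) ` set normal_forms"
      by (intro image_eqI[of _ _ "fold toggle moves b1"]) simp_all
  qed
  show "(\<lambda>b. Av_12 (cells b)) ` set normal_forms \<subseteq> (\<lambda>b. Av_12 (cells b)) ` {b. length b = 9}"
    by (intro image_mono) (auto simp: normal_forms_def length_fold_toggle set_reduced)
qed

text \<open>Equal avoidance classes have equal signatures, and these separate the normal
  forms.\<close>

lemma card_Av_12_normal_forms: "card ((\<lambda>b. Av_12 (cells b)) ` set normal_forms) = 56"
proof -
  have "inj_on signature (set normal_forms)"
    using normal_forms_separated by (simp add: distinct_map)
  then have "inj_on (\<lambda>b. Av_12 (cells b)) (set normal_forms)"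
    by (intro inj_onI) (auto dest: signature_eqI inj_onD)
  moreover have "card (set normal_forms) = 56"
    using normal_forms_separated by (simp add: distinct_card distinct_map)
  ultimately show ?thesis by (simp add: card_image)
qed

section \<open>From bit lists back to mesh patterns\<close>

lemma Pow_grid: "Pow grid = cells ` {b. length b = 9}"
proof
  show "Pow grid \<subseteq> cells ` {b. length b = 9}"
  proof
    fix R assume R: "R \<in> Pow grid"
    define b where "b = map (\<lambda>k. (k div 3, k mod 3) \<in> R) [0..<9]"
    have "b ! (3 * i + j) \<longleftrightarrow> (i, j) \<in> R" if "i < 3" "j < 3" for i j
      using that by (simp add: b_def del: upt_rec_numeral)
    moreover have "i < 3 \<and> j < 3" if "(i, j) \<in> R" for i j
      using R that by (auto simp: grid_def)
    ultimately have "cells b = R" by (auto simp: cells_def)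
    moreover have "length b = 9" by (simp add: b_def)
    ultimately show "R \<in> cells ` {b. length b = 9}" by blast
  qed
qed (auto dest: subsetD[OF cells_subset_grid])

lemma mesh_patterns_of_12: "mesh_patterns_of [1, 2] = Pair [1, 2] ` Pow grid"
proof -
  have "is_perm [1, 2]" by (auto simp: is_perm_iff)
  then show ?thesis
    by (force simp: mesh_patterns_of_def is_mesh_pattern_def grid_def numeral_2_eq_2)
qed

text \<open>The classes are the nonempty fibres of \<open>F\<close>, one for each value taken on
  \<open>M\<close>.\<close>

lemma card_quotient_kernel:
  assumes "r = {(x, y) \<in> M \<times> M. F x = F y}"
  shows "equiv M r" "card (M // r) = card (F ` M)"
proof -
  show "equiv M r"
    using assms by (auto intro!: equivI refl_onI symI transI)
  let ?fibre = "\<lambda>v. {y \<in> M. v = F y}"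
  have "M // r = ?fibre ` F ` M"
    using assms by (auto simp: quotient_def image_iff)
  moreover have "inj_on ?fibre (F ` M)"
    by (rule inj_onI) blast
  ultimately show "card (M // r) = card (F ` M)"
    by (simp add: card_image)
qed

theorem mainTheorem6:
  shows "card (mesh_patterns_of [1, 2]) = 512 \<and>
    equiv (mesh_patterns_of [1, 2]) (coincidence_under [2, 3, 1] (mesh_patterns_of [1, 2])) \<and>
    card (mesh_patterns_of [1, 2] // coincidence_under [2, 3, 1] (mesh_patterns_of [1, 2])) = 56"
proof (intro conjI)
  have "card (Pow grid) = 512" by (simp add: card_Pow grid_def)
  then show "card (mesh_patterns_of [1, 2]) = 512"
    unfolding mesh_patterns_of_12 by (simp add: card_image inj_on_def)
  have kernel: "coincidence_under [2, 3, 1] (mesh_patterns_of [1, 2]) =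
      {(p1, p2) \<in> mesh_patterns_of [1, 2] \<times> mesh_patterns_of [1, 2].
        Av {classical [2, 3, 1], p1} = Av {classical [2, 3, 1], p2}}"
    by (simp add: coincidence_under_def)
  show "equiv (mesh_patterns_of [1, 2]) (coincidence_under [2, 3, 1] (mesh_patterns_of [1, 2]))"
    by (rule card_quotient_kernel(1)[OF kernel])
  \<comment> \<open>Counting classes becomes counting distinct avoidance sets over bit lists, hence
    over normal forms.\<close>
  have "(\<lambda>p. Av {classical [2, 3, 1], p}) ` mesh_patterns_of [1, 2] =
      (\<lambda>b. Av_12 (cells b)) ` {b. length b = 9}"
    unfolding mesh_patterns_of_12 Pow_grid image_image Av_12_def ..
  then show "card (mesh_patterns_of [1, 2] // coincidence_under [2, 3, 1] (mesh_patterns_of [1, 2])) = 56"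
    unfolding card_quotient_kernel(2)[OF kernel] Av_12_normal_forms
    by (simp add: card_Av_12_normal_forms)
qed

end
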